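(* Let $m\ge 1$ and $u\in\mathcal{P}_m(\mathbb{R}^n)$. (i) If $n\neq 2$, then $$K[u(D)|x|^{2-n}]=\sum_{k=0}^{[m/2]}\ \sum_{\substack{(k_1,\dots,k_n)\in\mathbb{N}_0^n\\ k_1+\dots+k_n=k}}\frac{c_{m-k}}{2^k k_1!\cdots k_n!}\,|x|^{2k}\,D^{2k}_{x_1^{2k_1},\dots,x_n^{2k_n}}u,\qquad\text{where } c_m=\prod_{k=0}^{m-1}(2-n-2k).$$ (ii) If $n=2$, then $$K[u(D)\log|x|]=\sum_{k=0}^{[m/2]}\ \sum_{\substack{(k_1,k_2)\in\mathbb{N}_0^2\\ k_1+k_2=k}}\frac{\tilde c_{m-k}}{2^k k_1!\,k_2!}\,|x|^{2k}\,D^{2k}_{x_1^{2k_1},x_2^{2k_2}}u,\qquad\text{where } \tilde c_m=(-2)^{m-1}(m-1)!.$$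
   Context: $\mathcal{P}_m(\mathbb{R}^n)$ is the space of homogeneous polynomials of degree $m$ on $\mathbb{R}^n$ (complex coefficients, including the zero polynomial); $\mathbb{N}_0=\{0,1,2,\dots\}$; $[\cdot]$ is the integer part; $|x|=(\sum_j x_j^2)^{1/2}$. For $u=\sum_\alpha a_\alpha x^\alpha$, $u(D)=\sum_\alpha a_\alpha D^\alpha$ is the corresponding constant-coefficient differential operator, here applied to the function $x\mapsto|x|^{2-n}$ (resp. $x\mapsto\log|x|$) on $\mathbb{R}^n\setminus\{0\}$. $D^{2k}_{x_1^{2k_1},\dots,x_n^{2k_n}}u=\partial^{2k}u/\partial x_1^{2k_1}\cdots\partial x_n^{2k_n}$. The Kelvin transform of a function $f$ on $\mathbb{R}^n\setminus\{0\}$ is $K[f](x)=|x|^{2-n}f(x/|x|^2)$. The identities are identities of functions of $x\in\mathbb{R}^n\setminus\{0\}$. The formulas for $c_m$ and $\tilde c_m$ define these numbers for every index value occurring (so $c_{m-k}$, $\tilde c_{m-k}$ are obtained by replacing $m$ with $m-k\ge 1$). *)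

theory Defs
  imports "HOL-Analysis.Analysis" "HOL-Library.Poly_Mapping"
begin

text \<open>
  The space \<open>\<real>\<^sup>n\<close> is \<open>real ^ 'n\<close>, with \<open>n = CARD('n)\<close>. The index type is linearly ordered, like
  \<open>{1,\<dots>,n}\<close>; the order is used only to fix the order in which iterated partial derivatives are taken.
  A polynomial is given by its finitely supported family of coefficients, indexed by the
  exponents of the monomials.
\<close>

type_synonym 'n cpoly = "('n \<Rightarrow>\<^sub>0 nat) \<Rightarrow>\<^sub>0 complex"

definition hom_polys :: "nat \<Rightarrow> 'n::finite cpoly set" where
  "hom_polys m = {u. \<forall>\<alpha>\<in>Poly_Mapping.keys u. (\<Sum>i\<in>UNIV. Poly_Mapping.lookup \<alpha> i) = m}"

definition poly_fun :: "'n::finite cpoly \<Rightarrow> real ^ 'n \<Rightarrow> complex" where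
  "poly_fun u x = (\<Sum>\<alpha>\<in>Poly_Mapping.keys u. Poly_Mapping.lookup u \<alpha> *
     (\<Prod>i\<in>UNIV. complex_of_real (x $ i) ^ Poly_Mapping.lookup \<alpha> i))"

definition partial_deriv :: "'n::finite \<Rightarrow> (real ^ 'n \<Rightarrow> complex) \<Rightarrow> real ^ 'n \<Rightarrow> complex" where
  "partial_deriv i f x = vector_derivative (\<lambda>t. f (x + t *\<^sub>R axis i 1)) (at 0)"

definition multi_deriv ::
    "('n::{finite,linorder} \<Rightarrow> nat) \<Rightarrow>
     (real ^ ('n::{finite,linorder}) \<Rightarrow> complex) \<Rightarrow> real ^ ('n::{finite,linorder}) \<Rightarrow> complex" where
  "multi_deriv \<alpha> f = foldr (\<lambda>i. partial_deriv i ^^ \<alpha> i) (sorted_list_of_set UNIV) f"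

definition poly_diff_op ::
    "'n::{finite,linorder} cpoly \<Rightarrow>
     (real ^ ('n::{finite,linorder}) \<Rightarrow> complex) \<Rightarrow> real ^ ('n::{finite,linorder}) \<Rightarrow> complex" where
  "poly_diff_op u f x = (\<Sum>\<alpha>\<in>Poly_Mapping.keys u. Poly_Mapping.lookup u \<alpha> *
     multi_deriv (Poly_Mapping.lookup \<alpha>) f x)"

text \<open>The value at \<open>x = 0\<close> is irrelevant in the next definition.\<close>

definition kelvin :: "(real ^ 'n \<Rightarrow> complex) \<Rightarrow> real ^ 'n::finite \<Rightarrow> complex" where
  "kelvin f x = complex_of_real (norm x powi (2 - int CARD('n))) * f (x /\<^sub>R (norm x)\<^sup>2)"

definition c_coeff :: "nat \<Rightarrow> nat \<Rightarrow> real" where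
  "c_coeff n m = (\<Prod>k<m. 2 - real n - 2 * real k)"

text \<open>Only used for \<open>m \<ge> 1\<close>, where the subtraction is not truncated.\<close>

definition c_tilde :: "nat \<Rightarrow> real" where
  "c_tilde m = (-2) ^ (m - 1) * fact (m - 1)"

definition multi_indices :: "nat \<Rightarrow> ('n::finite \<Rightarrow> nat) set" where
  "multi_indices k = {\<kappa>. (\<Sum>i\<in>UNIV. \<kappa> i) = k}"

lemma finite_multi_indices: "finite (multi_indices k :: ('n::finite \<Rightarrow> nat) set)"
proof (rule finite_subset)
  show "(multi_indices k :: ('n \<Rightarrow> nat) set) \<subseteq> PiE UNIV (\<lambda>_. {..k})"
    by (auto simp: multi_indices_def intro: member_le_sum)
  show "finite (PiE (UNIV :: 'n set) (\<lambda>_. {..k}))"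
    by (intro finite_PiE) auto
qed

end

theory Submission
  imports Defs
begin

text \<open>
  The functions \<open>F\<^sub>j(y) = c\<^sub>j |y|\<^bsup>2-n-2j\<^esup>\<close> satisfy \<open>\<partial>\<^sub>i F\<^sub>j = y\<^sub>i F\<^bsub>j+1\<^esub>\<close>, because \<open>c\<^bsub>j+1\<^esub> = (2-n-2j) c\<^sub>j\<close>.
  In the plane the same holds once \<open>F\<^sub>0\<close> is taken to be \<open>log|y|\<close> and \<open>c\<^sub>j\<close> (\<open>j \<ge> 1\<close>) to be \<open>c\<close>-tilde. Both
  parts of the theorem are therefore one statement about such a chain (\<open>radial_chain\<close>).

  Along one axis, differentiating a product \<open>y\<^sub>i\<^sup>b F\<^sub>j\<close> either lowers \<open>b\<close>, with factor \<open>b\<close>, or raises both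
  \<open>b\<close> and \<open>j\<close>. These are the rules that generate the Hermite polynomials, so
  \<open>\<partial>\<^sub>i\<^sup>a F\<^sub>j = \<Sum>\<^sub>k a! / (2\<^sup>k k! (a-2k)!) y\<^sub>i\<^bsup>a-2k\<^esup> F\<^bsub>j+a-k\<^esub>\<close> (\<open>hermite_sum_has_vector_derivative\<close>).
  Here \<open>a! / (a-2k)! y\<^sub>i\<^bsup>a-2k\<^esup>\<close> is the \<open>2k\<close>-th derivative of \<open>y\<^sub>i\<^sup>a\<close>. Treating the coordinates one after
  another (\<open>foldr_partial_deriv_radial\<close>) gives, for \<open>|\<alpha>| = m\<close>,
  \<open>D\<^sup>\<alpha> F\<^sub>0 = \<Sum>\<^sub>\<kappa> (2\<^bsup>|\<kappa>|\<^esup> \<kappa>!)\<^bsup>-1\<^esup> (D\<^bsup>2\<kappa>\<^esup> y\<^sup>\<alpha>) F\<^bsub>m-|\<kappa>|\<^esub>\<close>,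
  which by linearity holds with \<open>u(D)\<close> and \<open>u\<close> in place of \<open>D\<^sup>\<alpha>\<close> and \<open>y\<^sup>\<alpha>\<close>.

  The term belonging to \<open>\<kappa>\<close>, with \<open>k = |\<kappa>|\<close>, is a homogeneous polynomial of degree \<open>m-2k\<close> times
  \<open>c\<^bsub>m-k\<^esub> |y|\<^bsup>2-n-2(m-k)\<^esup>\<close>. Counting powers of \<open>|x|\<close>, the Kelvin transform keeps the polynomial and
  turns the radial factor into \<open>c\<^bsub>m-k\<^esub> |x|\<^bsup>2k\<^esup>\<close> (\<open>kelvin_scaling\<close>). In the logarithmic case the
  exceptional function \<open>F\<^sub>0\<close> does not occur among the \<open>F\<^bsub>m-k\<^esub>\<close>, since \<open>m \<ge> 1\<close> and \<open>k \<le> m/2\<close>.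
\<close>

section \<open>Iterated partial derivatives\<close>

text \<open>
  Differentiation along one axis treats the other coordinates as constants. The weights \<open>w t\<close>
  collect the factors in those coordinates, and \<open>g t a\<close> is the \<open>a\<close>-th derivative of \<open>g t 0\<close>.
  Openness of \<open>S\<close> matters because \<open>partial_deriv\<close> is applied to functions whose formula is known
  only on \<open>S\<close>, such as functions singular at the origin.
\<close>

lemma iterated_partial_deriv_sum:
  fixes f :: "real ^ 'n::finite \<Rightarrow> complex" and g :: "'t \<Rightarrow> nat \<Rightarrow> real ^ 'n \<Rightarrow> complex"
  assumes "open S" and "x \<in> S"
    and f: "\<And>y. y \<in> S \<Longrightarrow> f y = (\<Sum>t\<in>T. w t y * g t 0 y)"
    and w: "\<And>t y s. w t (y + s *\<^sub>R axis i 1) = w t y"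
    and g: "\<And>t a y. t \<in> T \<Longrightarrow> y \<in> S \<Longrightarrow>
      ((\<lambda>s. g t a (y + s *\<^sub>R axis i 1)) has_vector_derivative g t (Suc a) y) (at 0)"
  shows "(partial_deriv i ^^ a) f x = (\<Sum>t\<in>T. w t x * g t a x)"
  using \<open>x \<in> S\<close>
proof (induction a arbitrary: x)
  case 0
  then show ?case using f by simp
next
  case (Suc a)
  have "((\<lambda>s. \<Sum>t\<in>T. w t (x + s *\<^sub>R axis i 1) * g t a (x + s *\<^sub>R axis i 1))
      has_vector_derivative (\<Sum>t\<in>T. w t x * g t (Suc a) x)) (at 0)"
    unfolding w by (intro has_vector_derivative_sum has_vector_derivative_mult_right g Suc.prems)
  moreover have "open ((\<lambda>s. x + s *\<^sub>R axis i 1) -` S)"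
    by (intro open_vimage \<open>open S\<close> continuous_intros)
  ultimately have "((\<lambda>s. (partial_deriv i ^^ a) f (x + s *\<^sub>R axis i 1))
      has_vector_derivative (\<Sum>t\<in>T. w t x * g t (Suc a) x)) (at 0)"
    by (rule has_vector_derivative_transform_within_open) (use Suc in auto)
  then show ?case
    by (simp add: partial_deriv_def[of i "(partial_deriv i ^^ a) f"] vector_derivative_at)
qed

lemma coordinate_power_has_vector_derivative:
  fixes y :: "real ^ 'n::finite"
  shows "((\<lambda>s. complex_of_real ((y + s *\<^sub>R axis i 1) $ i) ^ b) has_vector_derivative
    of_nat b * complex_of_real (y $ i) ^ (b - 1)) (at 0)"
proof -
  have "((\<lambda>s. complex_of_real ((y $ i + s) ^ b)) has_vector_derivative
      complex_of_real (of_nat b * (y $ i) ^ (b - 1))) (at 0)"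
    by (intro has_vector_derivative_of_real)
       (auto simp flip: has_real_derivative_iff_has_vector_derivative intro!: derivative_eq_intros)
  then show ?thesis by simp
qed

definition falling_fact :: "nat \<Rightarrow> nat \<Rightarrow> complex" where
  "falling_fact b a = fact a * of_nat (b choose a)"

lemma falling_fact_Suc: "falling_fact b (Suc a) = falling_fact b a * of_nat (b - a)"
proof -
  have "Suc a * (b choose Suc a) = (b choose a) * (b - a)"
    using binomial_absorb_comp[of b a] binomial_absorption[of a b] by (simp only: mult.commute)
  then have "fact a * of_nat (Suc a * (b choose Suc a)) =
      fact a * (of_nat ((b choose a) * (b - a)) :: complex)"
    by (rule arg_cong)
  then show ?thesis
    by (simp only: falling_fact_def fact_Suc of_nat_mult mult_ac)
qed

text \<open>
  The operators for the coordinates in the list have already acted on a monomial; those for the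
  remaining coordinates have not. This intermediate form is what makes induction on the list work,
  and distinctness ensures that the next coordinate still carries its original power.
\<close>

lemma foldr_partial_deriv_polynomial:
  fixes \<beta> :: "'t \<Rightarrow> 'n::finite \<Rightarrow> nat"
  assumes "distinct is"
  shows "foldr (\<lambda>i. partial_deriv i ^^ \<alpha> i) is
      (\<lambda>y. \<Sum>t\<in>T. c t * (\<Prod>j\<in>UNIV. complex_of_real (y $ j) ^ \<beta> t j)) x =
    (\<Sum>t\<in>T. c t * (\<Prod>j\<in>UNIV. if j \<in> set is
       then falling_fact (\<beta> t j) (\<alpha> j) * complex_of_real (x $ j) ^ (\<beta> t j - \<alpha> j)
       else complex_of_real (x $ j) ^ \<beta> t j))"
  using assms
proof (induction "is" arbitrary: x)
  case Nil
  then show ?case by simp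
next
  case (Cons i "is")
  let ?e = "\<lambda>js t j y. if j \<in> set js
       then falling_fact (\<beta> t j) (\<alpha> j) * complex_of_real (y $ j) ^ (\<beta> t j - \<alpha> j)
       else complex_of_real (y $ j) ^ \<beta> t j"
  let ?w = "\<lambda>t y. c t * (\<Prod>j\<in>UNIV - {i}. ?e is t j y)"
  let ?g = "\<lambda>t a y. falling_fact (\<beta> t i) a * complex_of_real (y $ i) ^ (\<beta> t i - a)"
  have i: "i \<notin> set is" "distinct is" using Cons.prems by auto
  have "(partial_deriv i ^^ \<alpha> i) (foldr (\<lambda>i. partial_deriv i ^^ \<alpha> i) is
      (\<lambda>y. \<Sum>t\<in>T. c t * (\<Prod>j\<in>UNIV. complex_of_real (y $ j) ^ \<beta> t j))) x =
    (\<Sum>t\<in>T. ?w t x * ?g t (\<alpha> i) x)"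
  proof (rule iterated_partial_deriv_sum[where S = UNIV])
    fix y :: "real ^ 'n"
    show "foldr (\<lambda>i. partial_deriv i ^^ \<alpha> i) is
      (\<lambda>y. \<Sum>t\<in>T. c t * (\<Prod>j\<in>UNIV. complex_of_real (y $ j) ^ \<beta> t j)) y =
      (\<Sum>t\<in>T. ?w t y * ?g t 0 y)"
      unfolding Cons.IH[OF i(2)]
      by (intro sum.cong refl, subst prod.remove[of UNIV i])
         (use i in \<open>auto simp: falling_fact_def\<close>)
  next
    fix t y and s :: real
    show "?w t (y + s *\<^sub>R axis i 1) = ?w t y"
      by (intro arg_cong2[where f = "(*)"] refl prod.cong) (auto simp: axis_def)
  next
    fix t a and y :: "real ^ 'n"
    show "((\<lambda>s. ?g t a (y + s *\<^sub>R axis i 1)) has_vector_derivative ?g t (Suc a) y) (at 0)"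
      using has_vector_derivative_mult_right[OF coordinate_power_has_vector_derivative,
          of "falling_fact (\<beta> t i) a" y i "\<beta> t i - a"]
      by (simp add: falling_fact_Suc mult.assoc)
  qed auto
  also have "\<dots> = (\<Sum>t\<in>T. c t * (\<Prod>j\<in>UNIV. ?e (i # is) t j x))"
  proof (intro sum.cong refl)
    fix t
    have "(\<Prod>j\<in>UNIV - {i}. ?e (i # is) t j x) = (\<Prod>j\<in>UNIV - {i}. ?e is t j x)"
      by (intro prod.cong) auto
    then show "?w t x * ?g t (\<alpha> i) x = c t * (\<Prod>j\<in>UNIV. ?e (i # is) t j x)"
      by (subst prod.remove[of UNIV i]) auto
  qed
  finally show ?case by simp
qed

lemma multi_deriv_poly_fun:
  "multi_deriv \<gamma> (poly_fun u) x =
    (\<Sum>\<alpha>\<in>Poly_Mapping.keys u. Poly_Mapping.lookup u \<alpha> *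
      (\<Prod>i\<in>UNIV. falling_fact (Poly_Mapping.lookup \<alpha> i) (\<gamma> i)
        * complex_of_real (x $ i) ^ (Poly_Mapping.lookup \<alpha> i - \<gamma> i)))"
  using foldr_partial_deriv_polynomial[of "sorted_list_of_set UNIV" \<gamma> "Poly_Mapping.lookup u"
      Poly_Mapping.lookup "Poly_Mapping.keys u" x]
  by (simp add: multi_deriv_def poly_fun_def[abs_def])

section \<open>Derivatives of radial functions\<close>

definition radial_chain :: "(nat \<Rightarrow> real ^ 'n::finite \<Rightarrow> complex) \<Rightarrow> bool" where
  "radial_chain F \<longleftrightarrow> (\<forall>j i y. y \<noteq> 0 \<longrightarrow>
    ((\<lambda>s. F j (y + s *\<^sub>R axis i 1)) has_vector_derivative
      complex_of_real (y $ i) * F (Suc j) y) (at 0))"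

lemma radial_chainI:
  fixes \<phi> :: "nat \<Rightarrow> real \<Rightarrow> real"
  assumes "\<And>j r. r > 0 \<Longrightarrow> (\<phi> j has_real_derivative r * \<phi> (Suc j) r) (at r)"
  shows "radial_chain (\<lambda>j (y :: real ^ 'n::finite). complex_of_real (\<phi> j (norm y)))"
  unfolding radial_chain_def
proof (intro allI impI)
  fix j i and y :: "real ^ 'n"
  assume "y \<noteq> 0"
  have "((\<lambda>s. norm (y + s *\<^sub>R axis i 1)) has_derivative
      (\<lambda>s. s * (y $ i / norm y))) (at 0)"
  proof -
    have "(norm has_derivative (\<lambda>h. sgn y \<bullet> h)) (at y)"
      using has_derivative_norm[OF \<open>y \<noteq> 0\<close>] by (simp add: inner_commute)
    then have "((norm \<circ> (\<lambda>s. y + s *\<^sub>R axis i 1)) has_derivative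
        ((\<lambda>h. sgn y \<bullet> h) \<circ> (\<lambda>s. s *\<^sub>R axis i 1))) (at (0::real))"
      by (intro diff_chain_at) (auto intro!: derivative_eq_intros)
    then show ?thesis
      by (simp add: o_def sgn_div_norm inner_axis divide_inverse mult_ac)
  qed
  then have n: "((\<lambda>s. norm (y + s *\<^sub>R axis i 1)) has_real_derivative y $ i / norm y) (at 0)"
    by (simp add: has_field_derivative_def mult.commute[of "y $ i / norm y", abs_def])
  have "((\<lambda>s. \<phi> j (norm (y + s *\<^sub>R axis i 1))) has_real_derivative
      (norm y * \<phi> (Suc j) (norm y)) * (y $ i / norm y)) (at 0)"
    by (rule DERIV_chain2[OF _ n]) (use assms \<open>y \<noteq> 0\<close> in simp)
  then have "((\<lambda>s. complex_of_real (\<phi> j (norm (y + s *\<^sub>R axis i 1)))) has_vector_derivative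
      complex_of_real (y $ i * \<phi> (Suc j) (norm y))) (at 0)"
    using \<open>y \<noteq> 0\<close>
    by (intro has_vector_derivative_of_real)
       (simp flip: has_real_derivative_iff_has_vector_derivative add: mult.commute)
  then show "((\<lambda>s. complex_of_real (\<phi> j (norm (y + s *\<^sub>R axis i 1)))) has_vector_derivative
      complex_of_real (y $ i) * complex_of_real (\<phi> (Suc j) (norm y))) (at 0)"
    by simp
qed

text \<open>
  This is \<open>a! / (2\<^sup>k k! (a-2k)!)\<close>, the absolute value of the coefficient of \<open>X\<^bsup>a-2k\<^esup>\<close> in the
  probabilists' Hermite polynomial of degree \<open>a\<close>. Written with the falling factorial, it vanishes
  for \<open>2k > a\<close>, so that the truncated exponents \<open>a - 2k\<close> below are harmless, and it displays the
  factor coming from the \<open>2k\<close>-th derivative of \<open>y\<^sub>i\<^sup>a\<close>.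
\<close>

definition hermite_coeff :: "nat \<Rightarrow> nat \<Rightarrow> complex" where
  "hermite_coeff a k = falling_fact a (2 * k) / (2 ^ k * fact k)"

lemma hermite_coeff_0: "hermite_coeff a 0 = 1"
  by (simp add: hermite_coeff_def falling_fact_def)

lemma hermite_coeff_eq_0: "a < 2 * k \<Longrightarrow> hermite_coeff a k = 0"
  by (simp add: hermite_coeff_def falling_fact_def)

text \<open>
  The two ways of reaching \<open>y\<^sub>i\<^bsup>a-2k-1\<^esup>\<close> by one differentiation: from the power one higher (index
  \<open>k\<close>) by lowering it, or from the power one lower (index \<open>k+1\<close>) by differentiating the radial factor.
  For \<open>2k \<ge> a\<close> both sides are zero.
\<close>

lemma hermite_coeff_Suc:
  "hermite_coeff (Suc a) (Suc k) = hermite_coeff a (Suc k) + of_nat (a - 2 * k) * hermite_coeff a k"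
proof -
  have "falling_fact (Suc a) (Suc (Suc (2 * k))) = falling_fact a (Suc (Suc (2 * k)))
      + 2 * of_nat (Suc k) * falling_fact a (Suc (2 * k))"
    by (simp add: falling_fact_def algebra_simps)
  also have "\<dots> = falling_fact a (2 * Suc k)
      + (2 * of_nat (Suc k)) * (falling_fact a (2 * k) * of_nat (a - 2 * k))"
    by (simp add: falling_fact_Suc[of a "2 * k"])
  finally have "hermite_coeff (Suc a) (Suc k) = hermite_coeff a (Suc k)
      + (2 * of_nat (Suc k)) * (falling_fact a (2 * k) * of_nat (a - 2 * k))
        / ((2 * of_nat (Suc k)) * (2 ^ k * fact k))"
    by (simp add: hermite_coeff_def add_divide_distrib mult_ac del: of_nat_Suc)
  then show ?thesis
    by (subst (asm) mult_divide_mult_cancel_left)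
       (simp_all add: hermite_coeff_def mult.commute del: of_nat_Suc)
qed

text \<open>
  The closed form of the \<open>a\<close>-th derivative of \<open>F j\<close> along the \<open>i\<close>-th axis. The offset \<open>j\<close> is the number
  of steps along the chain already made by derivatives in other coordinates.
\<close>

definition hermite_sum ::
    "(nat \<Rightarrow> real ^ 'n::finite \<Rightarrow> complex) \<Rightarrow> 'n \<Rightarrow> nat \<Rightarrow> nat \<Rightarrow> real ^ 'n \<Rightarrow> complex" where
  "hermite_sum F i j a y =
    (\<Sum>k\<le>a. hermite_coeff a k * complex_of_real (y $ i) ^ (a - 2 * k) * F (j + (a - k)) y)"

lemma hermite_sum_has_vector_derivative:
  assumes F: "radial_chain F" and "y \<noteq> 0"
  shows "((\<lambda>s. hermite_sum F i j a (y + s *\<^sub>R axis i 1)) has_vector_derivative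
    hermite_sum F i j (Suc a) y) (at 0)"
proof -
  let ?z = "complex_of_real (y $ i)"
  let ?T = "\<lambda>k. ?z ^ (Suc a - 2 * k) * F (j + (Suc a - k)) y"
  have "((\<lambda>s. hermite_sum F i j a (y + s *\<^sub>R axis i 1)) has_vector_derivative
    (\<Sum>k\<le>a. hermite_coeff a k * (?z ^ (a - 2 * k) * (?z * F (Suc (j + (a - k))) y)
       + of_nat (a - 2 * k) * ?z ^ (a - 2 * k - 1) * F (j + (a - k)) y))) (at 0)"
    unfolding hermite_sum_def mult.assoc[of "hermite_coeff _ _"]
  proof (intro has_vector_derivative_sum has_vector_derivative_mult_right)
    fix k
    have "((\<lambda>s. F (j + (a - k)) (y + s *\<^sub>R axis i 1)) has_vector_derivative
        ?z * F (Suc (j + (a - k))) y) (at 0)"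
      using assms unfolding radial_chain_def by blast
    from has_vector_derivative_mult[OF coordinate_power_has_vector_derivative[of y i "a - 2 * k"] this]
    show "((\<lambda>s. complex_of_real ((y + s *\<^sub>R axis i 1) $ i) ^ (a - 2 * k)
          * F (j + (a - k)) (y + s *\<^sub>R axis i 1)) has_vector_derivative
        ?z ^ (a - 2 * k) * (?z * F (Suc (j + (a - k))) y)
        + of_nat (a - 2 * k) * ?z ^ (a - 2 * k - 1) * F (j + (a - k)) y) (at 0)"
      by simp
  qed
  also have "(\<Sum>k\<le>a. hermite_coeff a k * (?z ^ (a - 2 * k) * (?z * F (Suc (j + (a - k))) y)
       + of_nat (a - 2 * k) * ?z ^ (a - 2 * k - 1) * F (j + (a - k)) y))
    = (\<Sum>k\<le>a. hermite_coeff a k * ?T k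
        + of_nat (a - 2 * k) * hermite_coeff a k * ?T (Suc k))"
  proof (intro sum.cong refl)
    fix k assume "k \<in> {..a}"
    show "hermite_coeff a k * (?z ^ (a - 2 * k) * (?z * F (Suc (j + (a - k))) y)
         + of_nat (a - 2 * k) * ?z ^ (a - 2 * k - 1) * F (j + (a - k)) y)
      = hermite_coeff a k * ?T k + of_nat (a - 2 * k) * hermite_coeff a k * ?T (Suc k)"
    proof (cases "2 * k \<le> a")
      case True
      then have "Suc a - 2 * k = Suc (a - 2 * k)" "Suc a - k = Suc (a - k)"
        "Suc a - 2 * Suc k = a - 2 * k - 1" "Suc a - Suc k = a - k"
        by auto
      then show ?thesis by (simp only:) (simp add: algebra_simps)
    qed (simp add: hermite_coeff_eq_0)
  qed
  \<comment> \<open>The term \<open>k = a + 1\<close> added to the first sum is zero, since \<open>2 * (a + 1) > a\<close>.\<close>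
  also have "\<dots> = (\<Sum>k\<le>Suc a. hermite_coeff a k * ?T k)
      + (\<Sum>k\<le>a. of_nat (a - 2 * k) * hermite_coeff a k * ?T (Suc k))"
    by (simp add: sum.distrib hermite_coeff_eq_0)
  also have "\<dots> = (\<Sum>k\<le>Suc a. hermite_coeff (Suc a) k * ?T k)"
    unfolding sum.atMost_Suc_shift
    by (simp add: hermite_coeff_0 hermite_coeff_Suc sum.distrib distrib_right)
  also have "\<dots> = hermite_sum F i j (Suc a) y"
    by (simp only: hermite_sum_def mult.assoc)
  finally show ?thesis .
qed

text \<open>
  The chain advances by \<open>\<alpha> i - \<kappa> i\<close> in each coordinate, and these advances add up. The powers of the
  coordinates already treated are constants for the next derivative, so the
  one-dimensional formula applies to every summand with its own offset.
\<close>

lemma foldr_partial_deriv_radial: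
  fixes \<alpha> :: "'n::finite \<Rightarrow> nat"
  assumes F: "radial_chain F" and "distinct is" and "x \<noteq> 0"
  shows "foldr (\<lambda>i. partial_deriv i ^^ \<alpha> i) is (F 0) x =
    (\<Sum>\<kappa>\<in>PiE (set is) (\<lambda>i. {..\<alpha> i}).
      (\<Prod>i\<in>set is. hermite_coeff (\<alpha> i) (\<kappa> i) * complex_of_real (x $ i) ^ (\<alpha> i - 2 * \<kappa> i))
        * F (\<Sum>i\<in>set is. \<alpha> i - \<kappa> i) x)"
  using assms(2,3)
proof (induction "is" arbitrary: x)
  case Nil
  then show ?case by simp
next
  case (Cons i "is")
  let ?h = "\<lambda>\<kappa> i y. hermite_coeff (\<alpha> i) (\<kappa> i) * complex_of_real (y $ i) ^ (\<alpha> i - 2 * \<kappa> i)"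
  let ?S = "PiE (set is) (\<lambda>i. {..\<alpha> i})"
  let ?N = "\<lambda>\<kappa>. \<Sum>i\<in>set is. \<alpha> i - \<kappa> i"
  have i: "i \<notin> set is" "distinct is" using Cons.prems by auto
  have "(partial_deriv i ^^ \<alpha> i) (foldr (\<lambda>i. partial_deriv i ^^ \<alpha> i) is (F 0)) x =
    (\<Sum>\<kappa>\<in>?S. (\<Prod>i\<in>set is. ?h \<kappa> i x) * hermite_sum F i (?N \<kappa>) (\<alpha> i) x)"
  proof (rule iterated_partial_deriv_sum[where S = "- {0}" and w = "\<lambda>\<kappa> y. \<Prod>i\<in>set is. ?h \<kappa> i y"])
    fix y :: "real ^ 'n"
    assume "y \<in> - {0}"
    then show "foldr (\<lambda>i. partial_deriv i ^^ \<alpha> i) is (F 0) y =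
      (\<Sum>\<kappa>\<in>?S. (\<Prod>i\<in>set is. ?h \<kappa> i y) * hermite_sum F i (?N \<kappa>) 0 y)"
      using Cons.IH[OF i(2)] by (simp add: hermite_sum_def hermite_coeff_0)
  next
    fix \<kappa> y and s :: real
    show "(\<Prod>j\<in>set is. ?h \<kappa> j (y + s *\<^sub>R axis i 1)) = (\<Prod>j\<in>set is. ?h \<kappa> j y)"
      using i by (intro prod.cong) (auto simp: axis_def)
  next
    fix \<kappa> a and y :: "real ^ 'n"
    assume "y \<in> - {0}"
    then show "((\<lambda>s. hermite_sum F i (?N \<kappa>) a (y + s *\<^sub>R axis i 1)) has_vector_derivative
        hermite_sum F i (?N \<kappa>) (Suc a) y) (at 0)"
      by (intro hermite_sum_has_vector_derivative F) auto
  qed (use Cons.prems in auto)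
  also have "\<dots> = (\<Sum>\<kappa>\<in>?S. \<Sum>k\<le>\<alpha> i. (\<Prod>j\<in>set (i # is). ?h (\<kappa>(i := k)) j x)
      * F (\<Sum>j\<in>set (i # is). \<alpha> j - (\<kappa>(i := k)) j) x)"
  proof (intro sum.cong refl)
    fix \<kappa>
    have "(\<Prod>j\<in>set (i # is). ?h (\<kappa>(i := k)) j x) = ?h (\<lambda>_. k) i x * (\<Prod>j\<in>set is. ?h \<kappa> j x)"
      for k
    proof -
      have "(\<Prod>j\<in>set is. ?h (\<kappa>(i := k)) j x) = (\<Prod>j\<in>set is. ?h \<kappa> j x)"
        using i by (intro prod.cong) auto
      then show ?thesis using i by simp
    qed
    moreover have "(\<Sum>j\<in>set (i # is). \<alpha> j - (\<kappa>(i := k)) j) = ?N \<kappa> + (\<alpha> i - k)" for k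
    proof -
      have "(\<Sum>j\<in>set is. \<alpha> j - (\<kappa>(i := k)) j) = ?N \<kappa>"
        using i by (intro sum.cong) auto
      then show ?thesis using i by simp
    qed
    ultimately show "(\<Prod>i\<in>set is. ?h \<kappa> i x) * hermite_sum F i (?N \<kappa>) (\<alpha> i) x =
      (\<Sum>k\<le>\<alpha> i. (\<Prod>j\<in>set (i # is). ?h (\<kappa>(i := k)) j x)
        * F (\<Sum>j\<in>set (i # is). \<alpha> j - (\<kappa>(i := k)) j) x)"
      by (simp only: hermite_sum_def sum_distrib_left) (simp add: mult_ac)
  qed
  also have "\<dots> = (\<Sum>\<kappa>\<in>PiE (set (i # is)) (\<lambda>i. {..\<alpha> i}). (\<Prod>j\<in>set (i # is). ?h \<kappa> j x)
      * F (\<Sum>j\<in>set (i # is). \<alpha> j - \<kappa> j) x)"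
    unfolding list.set PiE_insert_eq
    by (subst sum.reindex[OF inj_combinator[OF i(1)]], subst sum.swap)
       (simp add: sum.cartesian_product case_prod_unfold o_def)
  finally show ?case by simp
qed

section \<open>The Kelvin transform\<close>

text \<open>
  At \<open>x / |x|\<^sup>2\<close> a monomial of degree \<open>g = m - 2k\<close> gains the factor \<open>|x|\<^bsup>-2g\<^esup>\<close>, and the norm becomes
  \<open>|x|\<^bsup>-1\<^esup>\<close>. The total exponent of \<open>|x|\<close> is \<open>p - 2g - (p - 2(m-k)) = 2k\<close>.
\<close>

lemma kelvin_scaling:
  fixes x :: "real ^ 'n::finite" and \<gamma> :: "'n \<Rightarrow> nat"
  assumes "x \<noteq> 0" and m: "m = (\<Sum>i\<in>UNIV. \<gamma> i) + 2 * k"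
  shows "complex_of_real (norm x powi p) *
      ((\<Prod>i\<in>UNIV. complex_of_real ((x /\<^sub>R (norm x)\<^sup>2) $ i) ^ \<gamma> i)
       * complex_of_real (norm (x /\<^sub>R (norm x)\<^sup>2) powi (p - 2 * int (m - k)))) =
    complex_of_real (norm x ^ (2 * k)) * (\<Prod>i\<in>UNIV. complex_of_real (x $ i) ^ \<gamma> i)"
proof -
  define r where "r = norm x"
  define g where "g = (\<Sum>i\<in>UNIV. \<gamma> i)"
  have r: "r > 0" using assms by (simp add: r_def)
  have nrm: "norm (x /\<^sub>R r\<^sup>2) = inverse r"
    using r by (simp add: r_def[symmetric] power2_eq_square field_simps)
  have mon: "(\<Prod>i\<in>UNIV. complex_of_real ((x /\<^sub>R r\<^sup>2) $ i) ^ \<gamma> i) =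
      complex_of_real (inverse (r ^ (2 * g))) * (\<Prod>i\<in>UNIV. complex_of_real (x $ i) ^ \<gamma> i)"
    by (simp add: power_mult_distrib prod.distrib g_def power_mult power_inverse
        prod_inversef[unfolded o_def] power_sum)
  have pow: "r powi p * (inverse (r ^ (2 * g)) * inverse r powi (p - 2 * int (m - k)))
      = r ^ (2 * k)"
  proof -
    have "m - k = g + k" using m by (simp add: g_def)
    then have "inverse r powi (p - 2 * int (m - k)) = r powi (2 * int g + 2 * int k - p)"
      by (simp add: power_int_inverse flip: power_int_minus)
    also have "\<dots> = r ^ (2 * g) * r ^ (2 * k) / r powi p"
      using r by (simp add: power_int_diff power_int_add flip: power_int_of_nat)
    finally show ?thesis using r by simp
  qed
  have "complex_of_real (r powi p) * ((\<Prod>i\<in>UNIV. complex_of_real ((x /\<^sub>R r\<^sup>2) $ i) ^ \<gamma> i)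
        * complex_of_real (norm (x /\<^sub>R r\<^sup>2) powi (p - 2 * int (m - k)))) =
      complex_of_real (r powi p * (inverse (r ^ (2 * g)) * inverse r powi (p - 2 * int (m - k))))
        * (\<Prod>i\<in>UNIV. complex_of_real (x $ i) ^ \<gamma> i)"
    unfolding nrm mon of_real_mult by (simp only: mult_ac)
  then show ?thesis
    unfolding pow by (simp only: r_def)
qed

text \<open>
  The common form of both parts. The explicit shape of \<open>F j\<close> is demanded only for \<open>j \<ge> 1\<close>, which leaves
  room for the logarithm as \<open>F 0\<close>.
\<close>

lemma kelvin_poly_diff_op_radial:
  fixes u :: "'n::{finite,linorder} cpoly" and x :: "real ^ ('n::{finite,linorder})"
    and F :: "nat \<Rightarrow> real ^ ('n::{finite,linorder}) \<Rightarrow> complex" and c :: "nat \<Rightarrow> real"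
  assumes F: "radial_chain F" and "m \<ge> 1" and u: "u \<in> hom_polys m" and "x \<noteq> 0"
    and c: "\<And>j y. j \<ge> 1 \<Longrightarrow> y \<noteq> 0 \<Longrightarrow>
      F j y = complex_of_real (c j * norm y powi (2 - int CARD('n) - 2 * int j))"
  shows "kelvin (poly_diff_op u (F 0)) x =
    (\<Sum>k = 0..m div 2. \<Sum>\<kappa>\<in>multi_indices k.
      complex_of_real (c (m - k) / (2 ^ k * (\<Prod>i\<in>UNIV. fact (\<kappa> i))) * norm x ^ (2 * k))
      * multi_deriv (\<lambda>i. 2 * \<kappa> i) (poly_fun u) x)"
proof -
  let ?l = "Poly_Mapping.lookup"
  let ?p = "2 - int CARD('n)"
  let ?N = "\<lambda>\<kappa> :: 'n \<Rightarrow> nat. \<Sum>i\<in>UNIV. \<kappa> i"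
  let ?y = "x /\<^sub>R (norm x)\<^sup>2"
  let ?D = "\<lambda>\<alpha> \<kappa>. (\<Prod>i\<in>UNIV. falling_fact (?l \<alpha> i) (2 * \<kappa> i)
        * complex_of_real (x $ i) ^ (?l \<alpha> i - 2 * \<kappa> i))"
  let ?C = "\<lambda>\<kappa>. complex_of_real
      (c (m - ?N \<kappa>) / (2 ^ ?N \<kappa> * (\<Prod>i\<in>UNIV. fact (\<kappa> i))) * norm x ^ (2 * ?N \<kappa>))"
  let ?M = "{\<kappa>. ?N \<kappa> \<le> m div 2}"
  have y: "?y \<noteq> 0" using \<open>x \<noteq> 0\<close> by simp
  have M: "?M = (\<Union>k\<in>{0..m div 2}. multi_indices k)"
    by (auto simp: multi_indices_def)
  have finM: "finite ?M" unfolding M by (auto intro: finite_multi_indices)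
  \<comment> \<open>Both sides of the identity for a monomial have their nonzero terms where \<open>2\<kappa> \<le> \<alpha>\<close>; they are
    compared there, although one sum runs over a box and the other over a simplex.\<close>
  have monomial: "complex_of_real (norm x powi ?p) * multi_deriv (?l \<alpha>) (F 0) ?y = (\<Sum>\<kappa>\<in>?M. ?C \<kappa> * ?D \<alpha> \<kappa>)"
    if \<alpha>: "\<alpha> \<in> Poly_Mapping.keys u" for \<alpha>
  proof -
    let ?E = "{\<kappa>. \<forall>i. 2 * \<kappa> i \<le> ?l \<alpha> i}"
    let ?h = "\<lambda>\<kappa>. (\<Prod>i\<in>UNIV. hermite_coeff (?l \<alpha> i) (\<kappa> i)
        * complex_of_real (?y $ i) ^ (?l \<alpha> i - 2 * \<kappa> i))"
    have m: "?N (?l \<alpha>) = m" using u \<alpha> by (auto simp: hom_polys_def)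
    have "multi_deriv (?l \<alpha>) (F 0) ?y = (\<Sum>\<kappa>\<in>PiE UNIV (\<lambda>i. {..?l \<alpha> i}).
        ?h \<kappa> * F (\<Sum>i\<in>UNIV. ?l \<alpha> i - \<kappa> i) ?y)"
      using foldr_partial_deriv_radial[OF F _ y, of "sorted_list_of_set UNIV" "?l \<alpha>"]
      by (simp add: multi_deriv_def)
    also have "\<dots> = (\<Sum>\<kappa>\<in>?E. ?h \<kappa> * F (\<Sum>i\<in>UNIV. ?l \<alpha> i - \<kappa> i) ?y)"
    proof (intro sum.mono_neutral_right ballI)
      show "finite (PiE UNIV (\<lambda>i. {..?l \<alpha> i}))" by (intro finite_PiE) auto
      show "?E \<subseteq> PiE UNIV (\<lambda>i. {..?l \<alpha> i})"
        by auto (metis le_trans le_add1 mult_2)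
    next
      fix \<kappa> assume "\<kappa> \<in> PiE UNIV (\<lambda>i. {..?l \<alpha> i}) - ?E"
      then obtain i where "?l \<alpha> i < 2 * \<kappa> i" by (auto simp: not_le)
      then have "?h \<kappa> = 0" by (intro prod_zero) (auto intro!: exI[of _ i] simp: hermite_coeff_eq_0)
      then show "?h \<kappa> * F (\<Sum>i\<in>UNIV. ?l \<alpha> i - \<kappa> i) ?y = 0" by simp
    qed
    finally have "complex_of_real (norm x powi ?p) * multi_deriv (?l \<alpha>) (F 0) ?y =
        complex_of_real (norm x powi ?p) * (\<Sum>\<kappa>\<in>?E. ?h \<kappa> * F (\<Sum>i\<in>UNIV. ?l \<alpha> i - \<kappa> i) ?y)"
      by (rule arg_cong)
    also have "\<dots> = (\<Sum>\<kappa>\<in>?E. ?C \<kappa> * ?D \<alpha> \<kappa>)"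
      unfolding sum_distrib_left[of "complex_of_real (norm x powi ?p)"]
    proof (intro sum.cong refl)
      fix \<kappa> assume "\<kappa> \<in> ?E"
      then have \<kappa>: "2 * \<kappa> i \<le> ?l \<alpha> i" for i by auto
      then have \<kappa>': "\<kappa> i \<le> ?l \<alpha> i" for i
        using le_trans[of "\<kappa> i" "2 * \<kappa> i" "?l \<alpha> i"] by simp
      have deg: "m = (\<Sum>i\<in>UNIV. ?l \<alpha> i - 2 * \<kappa> i) + 2 * ?N \<kappa>"
        unfolding m[symmetric] sum_distrib_left sum.distrib[symmetric]
        by (intro sum.cong) (use \<kappa> in auto)
      have "(\<Sum>i\<in>UNIV. ?l \<alpha> i - \<kappa> i) + ?N \<kappa> = ?N (?l \<alpha>)"
        unfolding sum.distrib[symmetric]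
        by (intro sum.cong) (use \<kappa>' in auto)
      then have j: "(\<Sum>i\<in>UNIV. ?l \<alpha> i - \<kappa> i) = m - ?N \<kappa>" using m by simp
      have "m - ?N \<kappa> \<ge> 1" using deg \<open>m \<ge> 1\<close> by linarith
      then have Fj: "F (m - ?N \<kappa>) ?y =
          complex_of_real (c (m - ?N \<kappa>)) * complex_of_real (norm ?y powi (?p - 2 * int (m - ?N \<kappa>)))"
        using c[OF _ y] by simp
      \<comment> \<open>Their product is the coefficient in \<open>D\<^bsup>2\<kappa>\<^esup> x\<^sup>\<alpha>\<close>, up to the factor \<open>1 / (2\<^bsup>|\<kappa>|\<^esup> \<kappa>!)\<close>.\<close>
      have h: "(\<Prod>i\<in>UNIV. hermite_coeff (?l \<alpha> i) (\<kappa> i)) =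
          (\<Prod>i\<in>UNIV. falling_fact (?l \<alpha> i) (2 * \<kappa> i)) / (2 ^ ?N \<kappa> * (\<Prod>i\<in>UNIV. fact (\<kappa> i)))"
        by (simp add: hermite_coeff_def prod_dividef prod.distrib power_sum)
      have "complex_of_real (norm x powi ?p) * (?h \<kappa> * F (m - ?N \<kappa>) ?y) =
        complex_of_real (c (m - ?N \<kappa>)) * (\<Prod>i\<in>UNIV. hermite_coeff (?l \<alpha> i) (\<kappa> i)) *
        (complex_of_real (norm x powi ?p) *
          ((\<Prod>i\<in>UNIV. complex_of_real (?y $ i) ^ (?l \<alpha> i - 2 * \<kappa> i))
          * complex_of_real (norm ?y powi (?p - 2 * int (m - ?N \<kappa>)))))"
        by (simp only: Fj prod.distrib mult_ac)
      also have "\<dots> = ?C \<kappa> * ?D \<alpha> \<kappa>"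
        unfolding kelvin_scaling[OF \<open>x \<noteq> 0\<close> deg] h
        by (simp add: prod.distrib)
      finally show "complex_of_real (norm x powi ?p) * (?h \<kappa> * F (\<Sum>i\<in>UNIV. ?l \<alpha> i - \<kappa> i) ?y)
          = ?C \<kappa> * ?D \<alpha> \<kappa>"
        by (simp only: j)
    qed
    also have "\<dots> = (\<Sum>\<kappa>\<in>?M. ?C \<kappa> * ?D \<alpha> \<kappa>)"
    proof (intro sum.mono_neutral_left finM ballI subsetI)
      fix \<kappa> assume "\<kappa> \<in> ?E"
      then have "(\<Sum>i\<in>UNIV. 2 * \<kappa> i) \<le> ?N (?l \<alpha>)" by (intro sum_mono) auto
      then show "\<kappa> \<in> ?M" using m by (simp flip: sum_distrib_left)
    next
      fix \<kappa> assume "\<kappa> \<in> ?M - ?E"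
      then obtain i where "?l \<alpha> i < 2 * \<kappa> i" by (auto simp: not_le)
      then have "?D \<alpha> \<kappa> = 0"
        by (intro prod_zero) (auto intro!: exI[of _ i] simp: falling_fact_def)
      then show "?C \<kappa> * ?D \<alpha> \<kappa> = 0" by simp
    qed
    finally show ?thesis .
  qed
  have "kelvin (poly_diff_op u (F 0)) x = (\<Sum>\<alpha>\<in>Poly_Mapping.keys u. ?l u \<alpha> *
      (complex_of_real (norm x powi ?p) * multi_deriv (?l \<alpha>) (F 0) ?y))"
    by (simp add: kelvin_def poly_diff_op_def sum_distrib_left mult_ac)
  also have "\<dots> = (\<Sum>\<alpha>\<in>Poly_Mapping.keys u. ?l u \<alpha> * (\<Sum>\<kappa>\<in>?M. ?C \<kappa> * ?D \<alpha> \<kappa>))"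
    by (intro sum.cong refl) (simp only: monomial)
  also have "\<dots> = (\<Sum>\<kappa>\<in>?M. \<Sum>\<alpha>\<in>Poly_Mapping.keys u. ?l u \<alpha> * (?C \<kappa> * ?D \<alpha> \<kappa>))"
    unfolding sum_distrib_left by (rule sum.swap)
  also have "\<dots> = (\<Sum>\<kappa>\<in>?M. ?C \<kappa> * multi_deriv (\<lambda>i. 2 * \<kappa> i) (poly_fun u) x)"
    unfolding multi_deriv_poly_fun sum_distrib_left by (intro sum.cong refl) (simp only: mult_ac)
  also have "\<dots> = (\<Sum>k = 0..m div 2. \<Sum>\<kappa>\<in>multi_indices k.
      ?C \<kappa> * multi_deriv (\<lambda>i. 2 * \<kappa> i) (poly_fun u) x)"
    unfolding M by (rule sum.UNION_disjoint)
      (simp_all add: finite_multi_indices, auto simp: multi_indices_def)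
  also have "\<dots> = (\<Sum>k = 0..m div 2. \<Sum>\<kappa>\<in>multi_indices k.
      complex_of_real (c (m - k) / (2 ^ k * (\<Prod>i\<in>UNIV. fact (\<kappa> i))) * norm x ^ (2 * k))
      * multi_deriv (\<lambda>i. 2 * \<kappa> i) (poly_fun u) x)"
    by (intro sum.cong refl) (auto simp: multi_indices_def)
  finally show ?thesis .
qed

section \<open>The fundamental solutions as radial chains\<close>

lemma scaled_power_int_has_derivative:
  fixes r :: real
  assumes "r > 0"
  shows "((\<lambda>r. c * r powi q) has_real_derivative r * (c * of_int q * r powi (q - 2))) (at r)"
proof -
  have "r * r powi (q - 2) = r powi (q - 1)"
    using assms power_int_add_1'[of r "q - 2"] by simp
  then show ?thesis
    using assms by (auto intro!: derivative_eq_intros)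
qed

lemma radial_chain_power:
  fixes p :: int and c :: "nat \<Rightarrow> real"
  assumes "\<And>j. c (Suc j) = c j * (of_int p - 2 * real j)"
  shows "radial_chain (\<lambda>j (y :: real ^ 'n::finite).
    complex_of_real (c j * norm y powi (p - 2 * int j)))"
proof (rule radial_chainI)
  fix j and r :: real
  assume "r > 0"
  from scaled_power_int_has_derivative[OF this, of "c j" "p - 2 * int j"]
  show "((\<lambda>r. c j * r powi (p - 2 * int j)) has_real_derivative
      r * (c (Suc j) * r powi (p - 2 * int (Suc j)))) (at r)"
    by (simp add: assms algebra_simps)
qed

text \<open>
  With \<open>p = 0\<close> the preceding construction degenerates, as its coefficients vanish from \<open>j = 1\<close> on.
  Starting from the logarithm instead, one derivative leads to \<open>|y|\<^bsup>-2\<^esup>\<close> with coefficient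
  \<open>c_tilde 1 = 1\<close>, and from there on the recursion is that of the powers.
\<close>

lemma radial_chain_ln:
  "radial_chain (\<lambda>j (y :: real ^ 'n::finite). complex_of_real
    (if j = 0 then ln (norm y) else c_tilde j * norm y powi (- 2 * int j)))"
proof (rule radial_chainI)
  fix j and r :: real
  assume "r > 0"
  show "((\<lambda>r. if j = 0 then ln r else c_tilde j * r powi (- 2 * int j)) has_real_derivative
      r * (if Suc j = 0 then ln r else c_tilde (Suc j) * r powi (- 2 * int (Suc j)))) (at r)"
  proof (cases j)
    case 0
    have "r * r powi (-2) = 1 / r"
      using \<open>r > 0\<close> by (simp add: power_int_def power2_eq_square field_simps)
    then show ?thesis
      using \<open>r > 0\<close> 0 by (auto simp: c_tilde_def intro!: derivative_eq_intros)
  next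
    case (Suc l)
    have "c_tilde (Suc j) = c_tilde j * of_int (- 2 * int j)"
      by (simp add: c_tilde_def Suc algebra_simps)
    moreover have "- 2 * int (Suc j) = - 2 * int j - 2" by simp
    ultimately show ?thesis
      using scaled_power_int_has_derivative[OF \<open>r > 0\<close>, of "c_tilde j" "- 2 * int j"] Suc
      by (simp only:) simp
  qed
qed

theorem proposition1:
  fixes u :: "'n::{finite,linorder} cpoly" and m :: nat
  assumes "m \<ge> 1" and "u \<in> hom_polys m"
  shows "(CARD('n) \<noteq> 2 \<longrightarrow>
      (\<forall>x :: real ^ ('n::{finite,linorder}). x \<noteq> 0 \<longrightarrow>
        kelvin (poly_diff_op u (\<lambda>y. complex_of_real (norm y powi (2 - int CARD('n))))) x =
        (\<Sum>k = 0..m div 2. \<Sum>\<kappa>\<in>multi_indices k.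
          complex_of_real (c_coeff CARD('n) (m - k) / (2 ^ k * (\<Prod>i\<in>UNIV. fact (\<kappa> i)))
            * norm x ^ (2 * k))
          * multi_deriv (\<lambda>i. 2 * \<kappa> i) (poly_fun u) x))) \<and>
    (CARD('n) = 2 \<longrightarrow>
      (\<forall>x :: real ^ ('n::{finite,linorder}). x \<noteq> 0 \<longrightarrow>
        kelvin (poly_diff_op u (\<lambda>y. complex_of_real (ln (norm y)))) x =
        (\<Sum>k = 0..m div 2. \<Sum>\<kappa>\<in>multi_indices k.
          complex_of_real (c_tilde (m - k) / (2 ^ k * (\<Prod>i\<in>UNIV. fact (\<kappa> i)))
            * norm x ^ (2 * k))
          * multi_deriv (\<lambda>i. 2 * \<kappa> i) (poly_fun u) x)))"
proof (intro conjI impI allI)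
  fix x :: "real ^ ('n::{finite,linorder})"
  assume "x \<noteq> 0"
  have "radial_chain (\<lambda>j (y :: real ^ ('n::{finite,linorder})).
      complex_of_real (c_coeff CARD('n) j * norm y powi (2 - int CARD('n) - 2 * int j)))"
    by (rule radial_chain_power) (simp add: c_coeff_def)
  from kelvin_poly_diff_op_radial[OF this assms \<open>x \<noteq> 0\<close>, where c = "c_coeff CARD('n)"]
  show "kelvin (poly_diff_op u (\<lambda>y. complex_of_real (norm y powi (2 - int CARD('n))))) x =
        (\<Sum>k = 0..m div 2. \<Sum>\<kappa>\<in>multi_indices k.
          complex_of_real (c_coeff CARD('n) (m - k) / (2 ^ k * (\<Prod>i\<in>UNIV. fact (\<kappa> i)))
            * norm x ^ (2 * k))
          * multi_deriv (\<lambda>i. 2 * \<kappa> i) (poly_fun u) x)"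
    by (simp add: c_coeff_def)
next
  fix x :: "real ^ ('n::{finite,linorder})"
  assume n: "CARD('n) = 2" and "x \<noteq> 0"
  from kelvin_poly_diff_op_radial[OF radial_chain_ln assms \<open>x \<noteq> 0\<close>, where c = c_tilde]
  show "kelvin (poly_diff_op u (\<lambda>y. complex_of_real (ln (norm y)))) x =
        (\<Sum>k = 0..m div 2. \<Sum>\<kappa>\<in>multi_indices k.
          complex_of_real (c_tilde (m - k) / (2 ^ k * (\<Prod>i\<in>UNIV. fact (\<kappa> i)))
            * norm x ^ (2 * k))
          * multi_deriv (\<lambda>i. 2 * \<kappa> i) (poly_fun u) x)"
    by (simp add: n)
qed

end
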